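(* (In ZFC.) There exist a cellular-Lindelöf space $X$ and a space $Y$ of countable spread such that the product space $X\times Y$ is not cellular-Lindelöf.
   Context: All spaces are Hausdorff. A space is Lindelöf if every open cover has a countable subcover. A space is of countable spread if every discrete subspace of it is countable. A space $X$ is cellular-Lindelöf if for every family $\mathcal U$ of pairwise disjoint nonempty open subsets of $X$ there is a Lindelöf subspace $L\subset X$ such that $L\cap U\neq\emptyset$ for every $U\in\mathcal U$. *)

theory Defs
  imports "HOL-Analysis.Analysis"
begin

definition countable_spread :: "'a topology \<Rightarrow> bool" where
  "countable_spread X \<longleftrightarrow>
     (\<forall>D \<subseteq> topspace X. subtopology X D = discrete_topology D \<longrightarrow> countable D)"

definition cellular_Lindelof :: "'a topology \<Rightarrow> bool" where
  "cellular_Lindelof X \<longleftrightarrow>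
     (\<forall>\<U>. (\<forall>U\<in>\<U>. openin X U \<and> U \<noteq> {}) \<and> pairwise disjnt \<U> \<longrightarrow>
        (\<exists>L \<subseteq> topspace X. Lindelof_space (subtopology X L) \<and> (\<forall>U\<in>\<U>. L \<inter> U \<noteq> {})))"

(* HOL cannot quantify existentially over types, so a theorem asserting the existence of
   topological spaces must name a type containing their points.  The topspace of a topology
   on this type may be any subset of it, so the topologies on it are, up to homeomorphism,
   all spaces of cardinality at most beth_5.  An existence claim over
   these spaces implies the one without a cardinality bound. *)
type_synonym point = "real set set set set"

end

theory Submission
  imports Defs
begin

text \<open>
  Let \<open>Y\<close> be a set of reals of order type \<open>\<omega>\<^sub>1\<close> without uncountable closed subsets, with the real
  topology refined by making final segments open. A neighbourhood of a point is an open set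
  cut off below that point, and two points of a discrete subspace cannot use the same basic open
  set, so \<open>Y\<close> has countable spread.

  The isolated points of \<open>X\<close> are the countable subsets \<open>a\<close> of \<open>Y\<close>. Every \<open>B \<subseteq> Y\<close> is a branch
  through the nodes \<open>B \<inter> (-\<infinity>, b)\<close>, \<open>b \<in> B\<close>; placing such a node at the real \<open>b\<close>, the branch
  receives the points of \<open>\<real> - Y\<close> as limits, as in the Michael line. Since a closed set of reals
  inside \<open>Y\<close> is countable, each branch with its limits is Lindelof. Distinct branches have
  countably many common nodes, so adding one point at infinity yields a Hausdorff Lindelof space.

  Consider the disjoint open sets \<open>{a} \<times> {y. y > a}\<close>. A set \<open>L\<close> meeting all of them selects
  \<open>f a > a\<close> with \<open>(a, f a) \<in> L\<close>, and iterating \<open>f\<close> yields an uncountable branch \<open>B\<close> with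
  \<open>f (B \<inter> (-\<infinity>, b)) = b\<close>. So \<open>L\<close> contains all the pairs \<open>(B \<inter> (-\<infinity>, b), b)\<close>, and these have no
  condensation point in \<open>X \<times> Y\<close>: a limit \<open>(r, y)\<close> on the branch would have \<open>r = y\<close>, whereas
  \<open>r \<notin> Y\<close>. Hence \<open>L\<close> is not Lindelof.
\<close>

section \<open>Cardinality of closed sets of reals\<close>

text \<open>Cantor-Bendixson: discarding the points with a countable neighbourhood in
  \<open>F\<close> removes only countably many, and the condensation points \<open>P\<close> that
  remain form a nonempty perfect set, into which the reals embed.\<close>

lemma uncountable_closed_lepoll:
  fixes F :: "real set"
  assumes "closed F" "uncountable F"
  shows "(UNIV :: real set) \<lesssim> F"
proof -
  define P where "P = {x \<in> F. \<forall>e>0. uncountable (ball x e \<inter> F)}"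
  define \<B> where "\<B> = {ball x e | x e. countable (ball x e \<inter> F)}"
  have "\<And>S. S \<in> \<B> \<Longrightarrow> open S"
    by (auto simp: \<B>_def)
  then obtain \<B>' where B': "\<B>' \<subseteq> \<B>" "countable \<B>'" "\<Union>\<B>' = \<Union>\<B>"
    by (rule Lindelof)
  have "F - P \<subseteq> (\<Union>B\<in>\<B>'. B \<inter> F)"
  proof
    fix x assume x: "x \<in> F - P"
    then obtain e where "e > 0" "countable (ball x e \<inter> F)"
      by (auto simp: P_def)
    then have "x \<in> \<Union>\<B>"
      by (auto simp: \<B>_def intro!: exI[of _ "ball x e"])
    with B' x show "x \<in> (\<Union>B\<in>\<B>'. B \<inter> F)"
      by auto
  qed
  moreover have "countable (\<Union>B\<in>\<B>'. B \<inter> F)"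
    using B' by (intro countable_UN) (auto simp: \<B>_def)
  ultimately have FP: "countable (F - P)"
    using countable_subset by blast
  then have "P \<noteq> {}"
    using assms(2) by force
  have "x islimpt P \<longleftrightarrow> x \<in> P" for x
  proof
    assume x: "x islimpt P"
    have "P \<subseteq> F"
      by (auto simp: P_def)
    then have "x \<in> F"
      using assms(1) x by (meson closed_limpt islimpt_subset)
    moreover have "uncountable (ball x e \<inter> F)" if "e > 0" for e
    proof -
      obtain y where y: "y \<in> P" "dist y x < e"
        using x \<open>e > 0\<close> by (auto simp: islimpt_approachable)
      then have "uncountable (ball y (e - dist y x) \<inter> F)"
        by (auto simp: P_def)
      moreover have "ball y (e - dist y x) \<inter> F \<subseteq> ball x e \<inter> F"
        by (auto simp: dist_real_def)
      ultimately show ?thesis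
        using countable_subset by blast
    qed
    ultimately show "x \<in> P"
      by (simp add: P_def)
  next
    assume x: "x \<in> P"
    show "x islimpt P"
      unfolding islimpt_approachable
    proof (intro allI impI)
      fix e :: real assume "e > 0"
      then have "uncountable (ball x e \<inter> F)"
        using x by (auto simp: P_def)
      then have "uncountable (ball x e \<inter> F - ((F - P) \<union> {x}))"
        using FP by (intro uncountable_minus_countable) auto
      then obtain y where "y \<in> ball x e \<inter> F - ((F - P) \<union> {x})"
        by (metis countable_empty ex_in_conv)
      then show "\<exists>y\<in>P. y \<noteq> x \<and> dist y x < e"
        by (auto simp: dist_commute)
    qed
  qed
  moreover have "x \<in> euclidean derived_set_of P \<longleftrightarrow> x islimpt P" for x
    by (auto simp: in_derived_set_of islimpt_def)
  ultimately have "euclidean derived_set_of P = P"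
    by blast
  then have "(UNIV :: real set) \<lesssim> P"
    using \<open>P \<noteq> {}\<close> by (intro lepoll_perfect_set[of euclidean]) (auto simp: locally_compact_space_euclidean)
  also have "P \<lesssim> F"
    by (rule subset_imp_lepoll) (auto simp: P_def)
  finally show ?thesis .
qed

text \<open>A closed set is determined by the members of a countable basis that miss it, hence by a
  set of naturals.\<close>

lemma closed_sets_lepoll_reals: "{F :: real set. closed F} \<lesssim> (UNIV :: real set)"
proof -
  obtain \<B> :: "real set set" where \<B>: "countable \<B>" "topological_basis \<B>"
    using ex_countable_basis by blast
  have "{F :: real set. closed F} \<lesssim> (UNIV :: nat set set)"
    unfolding lepoll_def
  proof (intro exI conjI)
    define g where "g F = to_nat_on \<B> ` {B \<in> \<B>. B \<inter> F = {}}" for F :: "real set"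
    have *: "- F = \<Union>{B \<in> \<B>. B \<inter> F = {}}" if "closed F" for F
    proof -
      have "\<exists>B\<in>\<B>. x \<in> B \<and> B \<inter> F = {}" if "x \<notin> F" for x
        using topological_basisE[OF \<B>(2), of "- F" x] that \<open>closed F\<close>
        by (metis ComplI disjoint_eq_subset_Compl open_Compl)
      then show ?thesis
        by blast
    qed
    show "inj_on g {F. closed F}"
    proof (rule inj_onI)
      fix F G assume FG: "F \<in> {F. closed F}" "G \<in> {F. closed F}" "g F = g G"
      have "{B \<in> \<B>. B \<inter> F = {}} = {B \<in> \<B>. B \<inter> G = {}}"
        using FG(3) inj_on_to_nat_on[OF \<B>(1)] unfolding g_def
        by (subst (asm) inj_on_image_eq_iff[where C=\<B>]) auto
      then have "- F = - G"
        using *[of F] *[of G] FG(1,2) by simp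
      then show "F = G"
        by blast
    qed
  qed auto
  also have "\<dots> \<lesssim> (UNIV :: real set)"
    by (intro eqpoll_imp_lepoll nat_sets_eqpoll_reals)
  finally show ?thesis .
qed

section \<open>Sets of reals of type \<open>\<omega>\<^sub>1\<close> without uncountable closed
  subsets\<close>

text \<open>\<open>less\<close> well-orders the whole type, so that recursion along it is direct;
  \<open>countable_below\<close> and \<open>uncountable\<close> give \<open>Y\<close> the order type
  \<open>\<omega>\<^sub>1\<close>.\<close>

locale imperfect_well_order =
  fixes Y :: "real set" and less :: "real \<Rightarrow> real \<Rightarrow> bool" (infix \<open>\<sqsubset>\<close> 50)
  assumes wf: "wf {(x, y). x \<sqsubset> y}"
    and trans: "x \<sqsubset> y \<Longrightarrow> y \<sqsubset> z \<Longrightarrow> x \<sqsubset> z"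
    and total: "x \<noteq> y \<Longrightarrow> x \<sqsubset> y \<or> y \<sqsubset> x"
    and countable_below: "y \<in> Y \<Longrightarrow> countable {x \<in> Y. x \<sqsubset> y}"
    and uncountable: "uncountable Y"
    and imperfect: "closed F \<Longrightarrow> F \<subseteq> Y \<Longrightarrow> countable F"

text \<open>\<open>W\<close> collects the reals with countably many predecessors in some well-order.
  Were it countable, the least real outside \<open>W\<close> would have all its predecessors in
  \<open>W\<close>, and so would belong to \<open>W\<close>.\<close>

lemma ex_omega1_well_order:
  obtains W :: "real set" and less :: "real \<Rightarrow> real \<Rightarrow> bool"
  where "wf {(x, y). less x y}" "\<And>x y z. less x y \<Longrightarrow> less y z \<Longrightarrow> less x z"
    "\<And>x y. x \<noteq> y \<Longrightarrow> less x y \<or> less y x" "uncountable W"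
    "\<And>y. y \<in> W \<Longrightarrow> countable {x. less x y}"
proof -
  obtain r :: "real rel" where r: "well_order_on UNIV r"
    using well_order_on by blast
  define less where "less x y \<longleftrightarrow> (x, y) \<in> r - Id" for x y
  have "{(x, y). less x y} = r - Id"
    by (auto simp: less_def)
  with r have wf: "wf {(x, y). less x y}"
    by (simp add: well_order_on_def)
  have lin: "trans r" "antisym r" "total r"
    using r by (auto simp: well_order_on_def linear_order_on_def partial_order_on_def preorder_on_def)
  have tr: "less x z" if "less x y" "less y z" for x y z
    using that lin by (auto simp: less_def dest: transD antisymD)
  have tot: "less x y \<or> less y x" if "x \<noteq> y" for x y
    using that lin by (auto simp: less_def total_on_def)
  define W where "W = {y. countable {x. less x y}}"
  have "uncountable W"
  proof
    assume W: "countable W"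
    then have "W \<noteq> UNIV"
      using uncountable_UNIV_real by metis
    then obtain z where z: "z \<notin> W" "\<And>y. less y z \<Longrightarrow> y \<in> W"
      using wfE_min[OF wf, of _ "- W"] by (metis Compl_iff UNIV_eq_I case_prodI mem_Collect_eq)
    then have "{x. less x z} \<subseteq> W"
      by blast
    with W have "z \<in> W"
      unfolding W_def using countable_subset by blast
    with z show False
      by blast
  qed
  with wf tr tot show thesis
    by (intro that[of less W]) (auto simp: W_def)
qed

lemma ex_imperfect_well_order: "\<exists>Y less. imperfect_well_order Y less"
proof -
  obtain W :: "real set" and less
    where wf: "wf {(x, y). less x y}" and tr: "\<And>x y z. less x y \<Longrightarrow> less y z \<Longrightarrow> less x z"
    and tot: "\<And>x y. x \<noteq> y \<Longrightarrow> less x y \<or> less y x" and W: "uncountable W"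
    and below: "\<And>y. y \<in> W \<Longrightarrow> countable {x. less x y}"
    by (rule ex_omega1_well_order) (rule that)
  \<comment> \<open>Uncountable subsets of \<open>W\<close> inherit everything except the condition
    on closed sets.\<close>
  have *: "\<exists>Y less. imperfect_well_order Y less"
    if Y: "Y \<subseteq> W" "uncountable Y" "\<And>F. closed F \<Longrightarrow> F \<subseteq> Y \<Longrightarrow> countable F" for Y
  proof -
    have "imperfect_well_order Y less"
    proof (unfold_locales)
      show "countable {x \<in> Y. less x y}" if "y \<in> Y" for y
        by (rule countable_subset[OF _ below]) (use that Y in auto)
    qed (use wf tot Y in \<open>auto intro: tr\<close>)
    then show ?thesis
      by blast
  qed
  show ?thesis
  proof (cases "\<exists>F\<subseteq>W. closed F \<and> uncountable F")
    case False
    show ?thesis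
    proof (rule *[OF order_refl W])
      show "countable F" if "closed F" "F \<subseteq> W" for F
        using False that by blast
    qed
  next
    case True
    \<comment> \<open>Then \<open>W\<close> has the cardinality of the continuum, and so \<open>CH\<close> holds:
      a Bernstein recursion along \<open>W\<close> runs through all uncountable closed sets.\<close>
    then obtain F0 where F0: "F0 \<subseteq> W" "closed F0" "uncountable F0"
      by blast
    define \<C> where "\<C> = {F :: real set. closed F \<and> uncountable F}"
    have "\<C> \<lesssim> {F :: real set. closed F}"
      by (rule subset_imp_lepoll) (auto simp: \<C>_def)
    also note closed_sets_lepoll_reals
    also have "(UNIV :: real set) \<lesssim> F0"
      using F0 by (intro uncountable_closed_lepoll)
    also have "F0 \<lesssim> W"
      using F0 by (intro subset_imp_lepoll)
    \<comment> \<open>The chain of injections lets \<open>W\<close> enumerate all uncountable closed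
      sets, with only countably many stages before each.\<close>
    finally obtain c where c: "\<C> \<subseteq> c ` W"
      by (auto simp: lepoll_iff)
    \<comment> \<open>Stage \<open>w\<close> picks a pair: \<open>fst\<close> is a point of
      \<open>c w\<close> to be kept out of the final set, \<open>snd\<close> a new element of that
      set. \<open>fst\<close> avoids the earlier elements, \<open>snd\<close> everything chosen so
      far; \<open>W\<close> is a default when \<open>c w\<close> is not an uncountable closed
      set.\<close>
    define Q where "Q f w p \<longleftrightarrow> w \<in> W \<longrightarrow>
        fst p \<in> (if c w \<in> \<C> then c w else W) - snd ` f ` {v. less v w} \<and>
        snd p \<in> W - (insert (fst p) (snd ` f ` {v. less v w} \<union> fst ` f ` {v. less v w}))"
      for f :: "real \<Rightarrow> real \<times> real" and w p
    have "\<exists>f. \<forall>w. Q f w (f w)"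
    proof (rule dependent_wf_choice[OF wf])
      fix f g :: "real \<Rightarrow> real \<times> real" and w p
      assume "\<And>v. (v, w) \<in> {(x, y). less x y} \<Longrightarrow> f v = g v"
      then have "f ` {v. less v w} = g ` {v. less v w}"
        by (intro image_cong) auto
      then show "Q f w p = Q g w p"
        by (simp add: Q_def)
    next
      fix w and f :: "real \<Rightarrow> real \<times> real"
      show "\<exists>p. Q f w p"
      proof (cases "w \<in> W")
        case True
        let ?Z = "snd ` f ` {v. less v w}" and ?V = "fst ` f ` {v. less v w}"
        have c1: "countable ?Z" "countable ?V"
          using below[OF True] by auto
        have "uncountable (if c w \<in> \<C> then c w else W)"
          using W by (auto simp: \<C>_def)
        then have "uncountable ((if c w \<in> \<C> then c w else W) - ?Z)"
          using c1 by (intro uncountable_minus_countable)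
        then obtain z where z: "z \<in> (if c w \<in> \<C> then c w else W) - ?Z"
          by (metis countable_empty ex_in_conv)
        have "uncountable (W - insert z (?Z \<union> ?V))"
          using c1 W by (intro uncountable_minus_countable) auto
        then obtain y where y: "y \<in> W - insert z (?Z \<union> ?V)"
          by (metis countable_empty ex_in_conv)
        show ?thesis
          using y z by (intro exI[of _ "(z, y)"]) (simp add: Q_def)
      qed (simp add: Q_def)
    qed
    then obtain f where f: "\<And>w. Q f w (f w)"
      by blast
    have ne: "snd (f v) \<noteq> snd (f w)" "snd (f v) \<noteq> fst (f w)" "snd (f w) \<noteq> fst (f v)"
      if "less v w" "v \<in> W" "w \<in> W" for v w
    proof -
      have "snd (f v) \<in> snd ` f ` {v. less v w}" "fst (f v) \<in> fst ` f ` {v. less v w}"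
        using that by blast+
      moreover have "fst (f w) \<notin> snd ` f ` {v. less v w}"
        "snd (f w) \<notin> snd ` f ` {v. less v w}" "snd (f w) \<notin> fst ` f ` {v. less v w}"
        using f[of w] that unfolding Q_def by blast+
      ultimately show "snd (f v) \<noteq> snd (f w)" "snd (f v) \<noteq> fst (f w)" "snd (f w) \<noteq> fst (f v)"
        by metis+
    qed
    have ne_same: "snd (f w) \<noteq> fst (f w)" and in_W: "snd (f w) \<in> W"
      if "w \<in> W" for w
      using f[of w] that unfolding Q_def by auto
    have "inj_on (\<lambda>w. snd (f w)) W"
      by (rule inj_onI) (metis ne(1) tot)
    then have "uncountable ((\<lambda>w. snd (f w)) ` W)"
      using W countable_image_inj_on by blast
    moreover have "countable F" if F: "closed F" "F \<subseteq> (\<lambda>w. snd (f w)) ` W" for F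
    proof (rule ccontr)
      assume "uncountable F"
      with F have "F \<in> \<C>"
        by (simp add: \<C>_def)
      then have "F \<in> c ` W"
        using c by (rule subsetD[rotated])
      then obtain w where w: "w \<in> W" "c w = F"
        by blast
      \<comment> \<open>\<open>F\<close> contains the point withheld at its own stage
        \<open>w\<close>, and no stage \<open>v\<close> before, at or after \<open>w\<close> can
        have put that point into the set.\<close>
      have "fst (f w) \<in> F"
        using f[of w] w \<open>F \<in> \<C>\<close> by (simp add: Q_def)
      then have "fst (f w) \<in> (\<lambda>w. snd (f w)) ` W"
        using F(2) by (rule subsetD[rotated])
      then obtain v where v: "v \<in> W" "fst (f w) = snd (f v)"
        by blast
      consider "v = w" | "less v w" | "less w v"
        using tot by blast
      then show False
        by cases (use v w ne[of v w] ne[of w v] ne_same[of w] in simp_all)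
    qed
    moreover have "(\<lambda>w. snd (f w)) ` W \<subseteq> W"
      using in_W by blast
    ultimately show ?thesis
      using *[of "(\<lambda>w. snd (f w)) ` W"] by metis
  qed
qed

text \<open>\<open>Ray B r\<close> is the copy of the real \<open>r\<close> that serves as a limit of the branch \<open>B\<close>.\<close>

datatype branch_point = Node "real set" | Ray "real set" real | Infty

context imperfect_well_order
begin

lemma irrefl: "\<not> x \<sqsubset> x"
  using wf_not_refl[OF wf, of x] by simp

text \<open>An element of \<open>Y\<close> that is not above all of \<open>A\<close> lies in
  \<open>A\<close> or below a member of \<open>A\<close>, and there are only countably many of
  these.\<close>

lemma uncountable_above:
  assumes "countable A" "A \<subseteq> Y"
  shows "uncountable {y \<in> Y. \<forall>a\<in>A. a \<sqsubset> y}"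
proof
  assume c: "countable {y \<in> Y. \<forall>a\<in>A. a \<sqsubset> y}"
  have "Y \<subseteq> {y \<in> Y. \<forall>a\<in>A. a \<sqsubset> y} \<union> A \<union> (\<Union>a\<in>A. {x \<in> Y. x \<sqsubset> a})"
  proof
    fix y assume "y \<in> Y"
    show "y \<in> {y \<in> Y. \<forall>a\<in>A. a \<sqsubset> y} \<union> A \<union> (\<Union>a\<in>A. {x \<in> Y. x \<sqsubset> a})"
    proof (cases "\<forall>a\<in>A. a \<sqsubset> y")
      case False
      then obtain a where "a \<in> A" "\<not> a \<sqsubset> y"
        by blast
      with total[of a y] \<open>y \<in> Y\<close> show ?thesis
        by auto
    qed (use \<open>y \<in> Y\<close> in simp)
  qed
  moreover have "countable ({y \<in> Y. \<forall>a\<in>A. a \<sqsubset> y} \<union> A \<union> (\<Union>a\<in>A. {x \<in> Y. x \<sqsubset> a}))"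
    using assms c by (auto intro!: countable_below)
  ultimately have "countable Y"
    by (rule countable_subset)
  with uncountable show False
    by contradiction
qed

section \<open>The space of countable spread\<close>

text \<open>Since \<open>less\<close> is total, \<open>\<not> y \<sqsubset> x\<close> says that
  \<open>y\<close> is \<open>x\<close> or above it. Real open sets cut to the final segment from
  \<open>x\<close> are the basic neighbourhoods of \<open>x\<close>, so the order left-separates the
  space.\<close>

definition left_top :: "real topology" where
  "left_top = topology (\<lambda>U. U \<subseteq> Y \<and>
     (\<forall>x\<in>U. \<exists>V. open V \<and> x \<in> V \<and> {y \<in> V \<inter> Y. \<not> y \<sqsubset> x} \<subseteq> U))"

lemma openin_left_top:
  "openin left_top U \<longleftrightarrow> U \<subseteq> Y \<and>
     (\<forall>x\<in>U. \<exists>V. open V \<and> x \<in> V \<and> {y \<in> V \<inter> Y. \<not> y \<sqsubset> x} \<subseteq> U)"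
proof -
  have "istopology (\<lambda>U. U \<subseteq> Y \<and>
     (\<forall>x\<in>U. \<exists>V. open V \<and> x \<in> V \<and> {y \<in> V \<inter> Y. \<not> y \<sqsubset> x} \<subseteq> U))" (is "istopology ?P")
    unfolding istopology_def
  proof (intro conjI allI impI)
    fix S T assume ST: "?P S" "?P T"
    show "S \<inter> T \<subseteq> Y"
      using ST by blast
    show "\<forall>x\<in>S \<inter> T. \<exists>V. open V \<and> x \<in> V \<and> {y \<in> V \<inter> Y. \<not> y \<sqsubset> x} \<subseteq> S \<inter> T"
    proof
      fix x assume "x \<in> S \<inter> T"
      with ST obtain V W where "open V" "x \<in> V" "{y \<in> V \<inter> Y. \<not> y \<sqsubset> x} \<subseteq> S"
        "open W" "x \<in> W" "{y \<in> W \<inter> Y. \<not> y \<sqsubset> x} \<subseteq> T"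
        by blast
      then show "\<exists>V. open V \<and> x \<in> V \<and> {y \<in> V \<inter> Y. \<not> y \<sqsubset> x} \<subseteq> S \<inter> T"
        by (intro exI[of _ "V \<inter> W"]) auto
    qed
  next
    fix \<K> assume "\<forall>K\<in>\<K>. ?P K"
    then show "\<Union>\<K> \<subseteq> Y" "\<forall>x\<in>\<Union>\<K>. \<exists>V. open V \<and> x \<in> V \<and> {y \<in> V \<inter> Y. \<not> y \<sqsubset> x} \<subseteq> \<Union>\<K>"
      by (blast, meson UnionE Union_upper subset_trans)
  qed
  then show ?thesis
    unfolding left_top_def by simp
qed

lemma openin_left_top_Int: "open V \<Longrightarrow> openin left_top (V \<inter> Y)"
  unfolding openin_left_top by blast

lemma topspace_left_top [simp]: "topspace left_top = Y"
proof -
  have "openin left_top Y"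
    using openin_left_top_Int[of UNIV] by simp
  then show ?thesis
    unfolding topspace_def using openin_left_top by blast
qed

lemma openin_left_top_above: "openin left_top {y \<in> Y. \<forall>a\<in>A. a \<sqsubset> y}"
  unfolding openin_left_top
proof (intro conjI ballI exI)
  fix x assume "x \<in> {y \<in> Y. \<forall>a\<in>A. a \<sqsubset> y}"
  then show "{y \<in> UNIV \<inter> Y. \<not> y \<sqsubset> x} \<subseteq> {y \<in> Y. \<forall>a\<in>A. a \<sqsubset> y}"
    by (auto, metis total trans)
qed auto

lemma Hausdorff_left_top: "Hausdorff_space left_top"
  unfolding Hausdorff_space_def
proof (intro allI impI; elim conjE)
  fix x y assume xy: "x \<in> topspace left_top" "y \<in> topspace left_top" "x \<noteq> y"
  obtain U V :: "real set" where "open U" "open V" "x \<in> U" "y \<in> V" "U \<inter> V = {}"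
    using separation_t2 \<open>x \<noteq> y\<close> by metis
  with xy show "\<exists>U V. openin left_top U \<and> openin left_top V \<and> x \<in> U \<and> y \<in> V \<and> disjnt U V"
    by (intro exI[of _ "U \<inter> Y"] exI[of _ "V \<inter> Y"]) (auto simp: openin_left_top_Int disjnt_def)
qed

text \<open>Discreteness yields for each \<open>x\<close> in \<open>D\<close> a member of a
  countable basis of the reals in which \<open>x\<close> is the largest element of \<open>D\<close>.
  This set determines \<open>x\<close>, so \<open>h\<close> is injective.\<close>

lemma countable_spread_left_top: "countable_spread left_top"
  unfolding countable_spread_def
proof (intro allI impI)
  fix D assume D: "D \<subseteq> topspace left_top" "subtopology left_top D = discrete_topology D"
  obtain \<B> :: "real set set" where \<B>: "countable \<B>" "topological_basis \<B>"
    using ex_countable_basis by blast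
  have "\<exists>B\<in>\<B>. x \<in> B \<and> (\<forall>y\<in>B \<inter> D. y = x \<or> y \<sqsubset> x)" if "x \<in> D" for x
  proof -
    have "openin (subtopology left_top D) {x}"
      using that D by simp
    then obtain U where U: "openin left_top U" "{x} = U \<inter> D"
      by (auto simp: openin_subtopology)
    then obtain V where V: "open V" "x \<in> V" "{y \<in> V \<inter> Y. \<not> y \<sqsubset> x} \<subseteq> U"
      unfolding openin_left_top by blast
    obtain B where "B \<in> \<B>" "x \<in> B" "B \<subseteq> V"
      using topological_basisE[OF \<B>(2) V(1,2)] by blast
    with U V D show ?thesis
      by (intro bexI[of _ B]) auto
  qed
  then obtain h where h: "\<And>x. x \<in> D \<Longrightarrow> h x \<in> \<B> \<and> x \<in> h x \<and> (\<forall>y\<in>h x \<inter> D. y = x \<or> y \<sqsubset> x)"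
    by metis
  have "inj_on h D"
    by (rule inj_onI) (metis IntI h irrefl trans)
  moreover have "countable (h ` D)"
    by (rule countable_subset[OF _ \<B>(1)]) (use h in auto)
  ultimately show "countable D"
    using countable_image_inj_on by blast
qed

section \<open>The space of branches\<close>

definition below :: "real set \<Rightarrow> real \<Rightarrow> real set" where
  "below B b = {x \<in> B. x \<sqsubset> b}"

lemma inj_on_below: "inj_on (below B) B"
  by (rule inj_onI) (use total irrefl in \<open>auto simp: below_def set_eq_iff, metis\<close>)

definition branch_points :: "branch_point set" where
  "branch_points = {Node a | a. a \<subseteq> Y \<and> countable a} \<union> {Ray B r | B r. B \<subseteq> Y \<and> r \<notin> Y} \<union> {Infty}"

text \<open>The node \<open>below B b\<close> sits at the real \<open>b\<close>. \<open>V\<close>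
  localises in the reals, \<open>C\<close> lists positions whose nodes are omitted, and
  \<open>tube B UNIV {}\<close> is the full branch with its limits.\<close>

definition tube :: "real set \<Rightarrow> real set \<Rightarrow> real set \<Rightarrow> branch_point set" where
  "tube B V C = Ray B ` (V - Y) \<union> (\<lambda>b. Node (below B b)) ` (B \<inter> V - C)"

lemma tube_mono: "V \<subseteq> V' \<Longrightarrow> C' \<subseteq> C \<Longrightarrow> tube B V C \<subseteq> tube B V' C'"
  by (auto simp: tube_def)

lemma tube_subset: "B \<subseteq> Y \<Longrightarrow> tube B V C \<subseteq> branch_points"
  unfolding tube_def branch_points_def below_def
  by (auto intro!: countable_subset[OF _ countable_below])

lemma Node_in_tube_iff: "b \<in> B \<Longrightarrow> Node (below B b) \<in> tube B V C \<longleftrightarrow> b \<in> V - C"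
  using inj_on_below[of B] by (auto simp: tube_def dest: inj_onD)

text \<open>The neighbourhood condition defining the topology, applied to points \<open>x\<close> of
  \<open>U\<close>; hence \<open>True\<close> makes nodes isolated. A neighbourhood of
  \<open>Infty\<close> may omit countably many points and countably many full branches.\<close>

fun near :: "branch_point \<Rightarrow> branch_point set \<Rightarrow> bool" where
  "near (Node a) U = True"
| "near (Ray B r) U = (\<exists>V C. open V \<and> r \<in> V \<and> countable C \<and> tube B V C \<subseteq> U)"
| "near Infty U = (\<exists>\<B> N. countable \<B> \<and> \<B> \<subseteq> Pow Y \<and> countable N \<and>
     branch_points - N - (\<Union>B\<in>\<B>. tube B UNIV {}) \<subseteq> U)"

lemma near_RayI:
  "open V \<Longrightarrow> r \<in> V \<Longrightarrow> countable C \<Longrightarrow> tube B V C \<subseteq> U \<Longrightarrow> near (Ray B r) U"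
  by (simp only: near.simps) blast

lemma near_InftyI:
  "countable \<B> \<Longrightarrow> \<B> \<subseteq> Pow Y \<Longrightarrow> countable N \<Longrightarrow>
    branch_points - N - (\<Union>B\<in>\<B>. tube B UNIV {}) \<subseteq> U \<Longrightarrow> near Infty U"
  by (simp only: near.simps) blast

lemma near_mono: "near x U \<Longrightarrow> U \<subseteq> U' \<Longrightarrow> near x U'"
  by (cases x) (simp, (simp, meson subset_trans)+)

lemma near_Int: "near x U \<Longrightarrow> near x U' \<Longrightarrow> near x (U \<inter> U')"
proof (cases x)
  case (Ray B r)
  assume "near x U" "near x U'"
  with Ray obtain V C V' C' where "open V" "r \<in> V" "countable C" "tube B V C \<subseteq> U"
    "open V'" "r \<in> V'" "countable C'" "tube B V' C' \<subseteq> U'"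
    by auto
  with Ray show ?thesis
    using tube_mono[of "V \<inter> V'" V C "C \<union> C'" B] tube_mono[of "V \<inter> V'" V' C' "C \<union> C'" B]
    unfolding Ray by (intro near_RayI[of "V \<inter> V'" r "C \<union> C'" B]) auto
next
  case Infty
  assume "near x U" "near x U'"
  with Infty obtain \<B> N \<B>' N' where "countable \<B>" "\<B> \<subseteq> Pow Y" "countable N"
    "branch_points - N - (\<Union>B\<in>\<B>. tube B UNIV {}) \<subseteq> U"
    "countable \<B>'" "\<B>' \<subseteq> Pow Y" "countable N'"
    "branch_points - N' - (\<Union>B\<in>\<B>'. tube B UNIV {}) \<subseteq> U'"
    by auto
  with Infty show ?thesis
    unfolding Infty by (intro near_InftyI[of "\<B> \<union> \<B>'" "N \<union> N'"]) auto
qed auto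

definition branch_top :: "branch_point topology" where
  "branch_top = topology (\<lambda>U. U \<subseteq> branch_points \<and> (\<forall>x\<in>U. near x U))"

lemma openin_branch_top:
  "openin branch_top U \<longleftrightarrow> U \<subseteq> branch_points \<and> (\<forall>x\<in>U. near x U)"
proof -
  have "istopology (\<lambda>U. U \<subseteq> branch_points \<and> (\<forall>x\<in>U. near x U))"
    unfolding istopology_def by (blast intro: near_Int near_mono)
  then show ?thesis
    unfolding branch_top_def by simp
qed

lemma topspace_branch_top [simp]: "topspace branch_top = branch_points"
proof -
  have "near x branch_points" if "x \<in> branch_points" for x
  proof (cases x)
    case (Ray B r)
    with that have "B \<subseteq> Y"
      by (auto simp: branch_points_def)
    with Ray show ?thesis
      using near_RayI[of UNIV r "{}"] tube_subset by auto
  next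
    case Infty
    then show ?thesis
      using near_InftyI[of "{}" "{}"] by auto
  qed auto
  then have "openin branch_top branch_points"
    by (simp add: openin_branch_top)
  then show ?thesis
    unfolding topspace_def using openin_branch_top by blast
qed

lemma openin_Node: "a \<subseteq> Y \<Longrightarrow> countable a \<Longrightarrow> openin branch_top {Node a}"
  by (auto simp: openin_branch_top branch_points_def)

lemma openin_tube:
  assumes "B \<subseteq> Y" "open V" "countable C"
  shows "openin branch_top (tube B V C)"
  unfolding openin_branch_top
proof (intro conjI ballI)
  fix x assume "x \<in> tube B V C"
  then consider s where "x = Ray B s" "s \<in> V" | b where "x = Node (below B b)"
    by (auto simp: tube_def)
  then show "near x (tube B V C)"
    using assms near_RayI[of V _ C B] by cases auto
qed (use assms tube_subset in auto)

text \<open>By injectivity of \<open>below B\<close>, the node sits at no more than one real of each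
  branch, and putting that real into \<open>C\<close> keeps a tube away from it.\<close>

lemma openin_Compl_Node: "openin branch_top (branch_points - {Node a})"
  unfolding openin_branch_top
proof (intro conjI ballI)
  fix x assume x: "x \<in> branch_points - {Node a}"
  show "near x (branch_points - {Node a})"
  proof (cases x)
    case (Ray B r)
    define C where "C = {b \<in> B. below B b = a}"
    have "below B ` C \<subseteq> {a}"
      by (auto simp: C_def)
    moreover have "inj_on (below B) C"
      by (rule inj_on_subset[OF inj_on_below]) (simp add: C_def)
    ultimately have "countable C"
      by (meson countable_empty countable_image_inj_on countable_insert countable_subset)
    moreover have "tube B UNIV C \<subseteq> branch_points"
      using x Ray by (intro tube_subset) (simp add: branch_points_def)
    moreover have "Node a \<notin> tube B UNIV C"
      by (auto simp: tube_def C_def)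
    ultimately show ?thesis
      unfolding Ray by (intro near_RayI[of UNIV r C B]) auto
  next
    case Infty
    then show ?thesis
      using near_InftyI[of "{}" "{Node a}"] by auto
  qed auto
qed auto

text \<open>A node lying on both branches makes \<open>B\<close> and \<open>B'\<close> agree below it, so if such nodes were
  cofinal in \<open>B'\<close> then the two branches would be equal.\<close>

lemma countable_common_nodes:
  assumes "B \<subseteq> Y" "B' \<subseteq> Y" "B \<noteq> B'"
  shows "countable {b' \<in> B'. \<exists>b\<in>B. below B' b' = below B b}" (is "countable ?E")
proof (rule ccontr)
  assume unc: "\<not> countable ?E"
  have large: "\<exists>b'\<in>?E. x \<sqsubset> b'" if "x \<in> Y" for x
  proof (rule ccontr)
    assume "\<not> (\<exists>b'\<in>?E. x \<sqsubset> b')"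
    then have "?E \<subseteq> insert x {y \<in> Y. y \<sqsubset> x}"
      using total assms by blast
    with unc that countable_below show False
      by (metis (lifting) countable_insert countable_subset)
  qed
  have "x \<in> B \<longleftrightarrow> x \<in> B'" if "x \<in> Y" for x
  proof -
    obtain b1 where b1: "b1 \<in> ?E" "x \<sqsubset> b1"
      using large[OF \<open>x \<in> Y\<close>] by blast
    obtain b2 where b2: "b2 \<in> ?E" "b1 \<sqsubset> b2"
      using large[of b1] b1 assms by blast
    then obtain b where b: "b \<in> B" "below B' b2 = below B b"
      by blast
    have "b1 \<in> below B' b2"
      using b1 b2 by (simp add: below_def)
    then have "b1 \<sqsubset> b"
      unfolding b by (simp add: below_def)
    then have "x \<sqsubset> b" "x \<sqsubset> b2"
      using b1 b2 trans by blast+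
    then show ?thesis
      using b(2) by (auto simp: below_def set_eq_iff)
  qed
  with assms show False
    by blast
qed

text \<open>Around a ray of another branch \<open>B'\<close>, the countably many positions of common
  nodes go into \<open>C\<close>; neighbourhoods of \<open>Infty\<close> may omit full branches.
  With \<open>openin_tube\<close>, full branches are clopen.\<close>

lemma openin_Compl_tube:
  assumes B: "B \<subseteq> Y"
  shows "openin branch_top (branch_points - tube B UNIV {})"
  unfolding openin_branch_top
proof (intro conjI ballI)
  fix x assume x: "x \<in> branch_points - tube B UNIV {}"
  show "near x (branch_points - tube B UNIV {})"
  proof (cases x)
    case (Ray B' r)
    with x have B': "B' \<subseteq> Y" "B' \<noteq> B"
      by (auto simp: branch_points_def tube_def)
    define C where "C = {b' \<in> B'. \<exists>b\<in>B. below B' b' = below B b}"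
    have "countable C"
      unfolding C_def using B B' by (intro countable_common_nodes) auto
    moreover have "tube B' UNIV C \<inter> tube B UNIV {} = {}"
      using B' by (auto simp: tube_def C_def)
    ultimately show ?thesis
      unfolding Ray using tube_subset[OF B'(1)] by (intro near_RayI[of UNIV r C B']) auto
  next
    case Infty
    then show ?thesis
      using B near_InftyI[of "{B}" "{}"] by auto
  qed auto
qed auto

text \<open>Single nodes and full branches are clopen, which separates all pairs except two rays of
  one branch; for these, disjoint open sets of reals give disjoint tubes.\<close>

lemma Hausdorff_branch_top: "Hausdorff_space branch_top"
proof -
  define sep where "sep x y \<longleftrightarrow>
      (\<exists>U V. openin branch_top U \<and> openin branch_top V \<and> x \<in> U \<and> y \<in> V \<and> disjnt U V)" for x y
  have sep_sym: "sep y x" if "sep x y" for x y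
    using that unfolding sep_def by (metis disjnt_sym)
  have Node: "sep (Node a) y" if "Node a \<in> branch_points" "y \<in> branch_points" "y \<noteq> Node a" for a y
    unfolding sep_def
    using that openin_Node[of a] openin_Compl_Node[of a]
    by (intro exI[of _ "{Node a}"] exI[of _ "branch_points - {Node a}"])
      (auto simp: branch_points_def disjnt_def)
  have tube: "sep (Ray B r) y" if "Ray B r \<in> branch_points" "y \<in> branch_points - tube B UNIV {}" for B r y
    unfolding sep_def
    using that openin_tube[of B UNIV "{}"] openin_Compl_tube[of B]
    by (intro exI[of _ "tube B UNIV {}"] exI[of _ "branch_points - tube B UNIV {}"])
      (auto simp: branch_points_def disjnt_def tube_def)
  have Ray: "sep (Ray B r) (Ray B s)"
    if "Ray B r \<in> branch_points" "Ray B s \<in> branch_points" "r \<noteq> s" for B r s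
  proof -
    obtain U V :: "real set" where UV: "open U" "open V" "r \<in> U" "s \<in> V" "U \<inter> V = {}"
      using separation_t2 \<open>r \<noteq> s\<close> by metis
    have "tube B U {} \<inter> tube B V {} = {}"
      using UV inj_on_below[of B] by (auto simp: tube_def dest: inj_onD)
    moreover have "Ray B r \<in> tube B U {}" "Ray B s \<in> tube B V {}" "B \<subseteq> Y"
      using that UV by (auto simp: tube_def branch_points_def)
    ultimately show ?thesis
      using openin_tube[of B _ "{}"] UV unfolding sep_def disjnt_def
      by (intro exI[of _ "tube B U {}"] exI[of _ "tube B V {}"]) auto
  qed
  have "sep x y" if xy: "x \<in> branch_points" "y \<in> branch_points" "x \<noteq> y" for x y
  proof -
    have Infty: "Infty \<notin> tube B UNIV {}" for B
      by (auto simp: tube_def)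
    consider a where "x = Node a" | a where "y = Node a"
      | B r B' s where "x = Ray B r" "y = Ray B' s"
      | B r where "x = Ray B r" "y = Infty" | B r where "x = Infty" "y = Ray B r"
      using xy by (cases x; cases y) auto
    then show ?thesis
    proof cases
      case 3
      then show ?thesis
        using xy Ray tube[of B r y] by (cases "B = B'") (auto simp: tube_def)
    next
      case 4
      then show ?thesis
        using xy tube Infty by blast
    next
      case 5
      then show ?thesis
        using xy tube Infty sep_sym by blast
    qed (use xy Node sep_sym in blast)+
  qed
  then show ?thesis
    unfolding Hausdorff_space_def sep_def by simp
qed

text \<open>Countably many of the sets \<open>V r\<close> cover \<open>- Y\<close>. The nodes missed
  by their tubes sit at countably many reals, and one further member of the cover is spent on
  each.\<close>

lemma Lindelof_tube:
  assumes B: "B \<subseteq> Y"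
    and \<U>: "\<And>U. U \<in> \<U> \<Longrightarrow> openin branch_top U" "tube B UNIV {} \<subseteq> \<Union>\<U>"
  shows "\<exists>\<V>\<subseteq>\<U>. countable \<V> \<and> tube B UNIV {} \<subseteq> \<Union>\<V>"
proof -
  have "\<exists>U V C. U \<in> \<U> \<and> open V \<and> r \<in> V \<and> countable C \<and> tube B V C \<subseteq> U" if r: "r \<notin> Y" for r
  proof -
    from r have "Ray B r \<in> tube B UNIV {}"
      by (simp add: tube_def)
    then have "Ray B r \<in> \<Union>\<U>"
      using \<U>(2) by blast
    then obtain U where "U \<in> \<U>" "Ray B r \<in> U"
      by blast
    with \<U>(1) have "near (Ray B r) U"
      using openin_branch_top by blast
    with \<open>U \<in> \<U>\<close> show ?thesis
      unfolding near.simps by blast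
  qed
  then obtain U V C where UVC: "\<And>r. r \<notin> Y \<Longrightarrow> U r \<in> \<U> \<and> open (V r) \<and> r \<in> V r \<and>
      countable (C r) \<and> tube B (V r) (C r) \<subseteq> U r"
    by metis
  obtain \<G> where \<G>: "\<G> \<subseteq> V ` (- Y)" "countable \<G>" "\<Union>\<G> = \<Union>(V ` (- Y))"
    by (rule Lindelof[of "V ` (- Y)"]) (use UVC in auto)
  obtain R where R: "R \<subseteq> - Y" "countable R" "\<G> = V ` R"
    using countable_subset_image[of \<G> V "- Y"] \<G> by auto
  define G where "G = (\<Union>r\<in>R. V r)"
  have cover: "- Y \<subseteq> G"
    using \<G> R UVC by (auto simp: G_def)
  have "open G"
    using UVC R by (auto simp: G_def)
  \<comment> \<open>Here the choice of \<open>Y\<close> matters: \<open>- G\<close> is a closed set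
    of reals contained in \<open>Y\<close>.\<close>
  then have "countable (- G)"
    using cover by (intro imperfect) auto
  \<comment> \<open>Positions of nodes that the chosen tubes may miss: outside every
    \<open>V r\<close>, or exempted by some \<open>C r\<close>.\<close>
  define N where "N = (- G) \<union> (\<Union>r\<in>R. C r)"
  have "countable N"
    using \<open>countable (- G)\<close> R UVC by (auto simp: N_def)
  have "\<exists>U'\<in>\<U>. Node (below B b) \<in> U'" if "b \<in> B" for b
    using \<U>(2) that by (auto simp: tube_def)
  then obtain W where W: "\<And>b. b \<in> B \<Longrightarrow> W b \<in> \<U> \<and> Node (below B b) \<in> W b"
    by metis
  have "tube B UNIV {} \<subseteq> \<Union>(U ` R \<union> W ` (B \<inter> N))"
  proof
    fix x assume "x \<in> tube B UNIV {}"
    then consider s where "x = Ray B s" "s \<notin> Y"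
      | b where "x = Node (below B b)" "b \<in> B"
      by (auto simp: tube_def)
    then show "x \<in> \<Union>(U ` R \<union> W ` (B \<inter> N))"
    proof cases
      case 1
      then obtain r where r: "r \<in> R" "s \<in> V r"
        using cover by (auto simp: G_def)
      with 1 have "x \<in> tube B (V r) (C r)"
        by (auto simp: tube_def)
      with r R UVC show ?thesis
        by blast
    next
      case 2
      show ?thesis
      proof (cases "b \<in> N")
        case False
        then obtain r where r: "r \<in> R" "b \<in> V r" "b \<notin> C r"
          by (auto simp: N_def G_def)
        with 2 have "x \<in> tube B (V r) (C r)"
          by (auto simp: tube_def)
        with r R UVC show ?thesis
          by blast
      qed (use 2 W in auto)
    qed
  qed
  moreover have "U ` R \<union> W ` (B \<inter> N) \<subseteq> \<U>"
    using UVC R W by auto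
  moreover have "countable (U ` R \<union> W ` (B \<inter> N))"
    using R \<open>countable N\<close> by auto
  ultimately show ?thesis
    by blast
qed

text \<open>A member of the cover that contains \<open>Infty\<close> leaves only countably many
  points and countably many full branches, each of which is Lindelof.\<close>

lemma Lindelof_branch_top: "Lindelof_space branch_top"
  unfolding Lindelof_space_alt
proof (intro allI impI; elim conjE)
  fix \<U> assume \<U>: "\<forall>U\<in>\<U>. openin branch_top U" "topspace branch_top \<subseteq> \<Union>\<U>"
  then have "Infty \<in> \<Union>\<U>"
    by (auto simp: branch_points_def)
  then obtain U where U: "U \<in> \<U>" "Infty \<in> U"
    by blast
  then have "near Infty U"
    using \<U>(1) openin_branch_top by blast
  then obtain \<B> N where \<B>N: "countable \<B>" "\<B> \<subseteq> Pow Y" "countable N"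
    "branch_points - N - (\<Union>B\<in>\<B>. tube B UNIV {}) \<subseteq> U"
    unfolding near.simps by blast
  have "\<exists>\<V>\<subseteq>\<U>. countable \<V> \<and> tube B UNIV {} \<subseteq> \<Union>\<V>" if "B \<in> \<B>" for B
  proof (rule Lindelof_tube)
    show "B \<subseteq> Y"
      using that \<B>N by auto
    then show "tube B UNIV {} \<subseteq> \<Union>\<U>"
      using \<U>(2) tube_subset[of B UNIV "{}"] by simp
  qed (use \<U> in auto)
  then obtain \<V> where \<V>:
    "\<And>B. B \<in> \<B> \<Longrightarrow> \<V> B \<subseteq> \<U> \<and> countable (\<V> B) \<and> tube B UNIV {} \<subseteq> \<Union>(\<V> B)"
    by metis
  have "\<exists>U\<in>\<U>. x \<in> U" if "x \<in> branch_points" for x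
    using \<U> that by auto
  then obtain W where W: "\<And>x. x \<in> branch_points \<Longrightarrow> W x \<in> \<U> \<and> x \<in> W x"
    by metis
  let ?\<V> = "insert U ((\<Union>B\<in>\<B>. \<V> B) \<union> W ` (N \<inter> branch_points))"
  have "branch_points \<subseteq> \<Union>?\<V>"
  proof
    fix x assume x: "x \<in> branch_points"
    consider "x \<in> N" | B where "B \<in> \<B>" "x \<in> tube B UNIV {}" | "x \<in> U"
      using x \<B>N(4) by blast
    then show "x \<in> \<Union>?\<V>"
    proof cases
      case 1
      with x W show ?thesis
        by blast
    next
      case 2
      with \<V>[of B] have "x \<in> \<Union>(\<V> B)"
        by blast
      with 2 show ?thesis
        by blast
    qed blast
  qed
  moreover have "?\<V> \<subseteq> \<U>" "countable ?\<V>"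
    using U \<V> W \<B>N by auto
  ultimately show "\<exists>\<V>. countable \<V> \<and> \<V> \<subseteq> \<U> \<and> topspace branch_top \<subseteq> \<Union>\<V>"
    unfolding topspace_branch_top by (intro exI[of _ ?\<V>] conjI)
qed

section \<open>The product is not cellular-Lindelof\<close>

text \<open>If \<open>B\<close> were countable, \<open>f B\<close> would lie above all of
  \<open>B\<close> with \<open>B\<close> as the part below it, so it would satisfy the defining
  recursion and belong to \<open>B\<close>, hence lie above itself.\<close>

lemma ex_guided_branch:
  assumes f: "\<And>a. a \<subseteq> Y \<Longrightarrow> countable a \<Longrightarrow> f a \<in> Y \<and> (\<forall>x\<in>a. x \<sqsubset> f a)"
  obtains B where "B \<subseteq> Y" "uncountable B" "\<And>b. b \<in> B \<Longrightarrow> f (below B b) = b"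
proof -
  \<comment> \<open>Transfinite iteration of \<open>f\<close> as a predicate: \<open>b\<close> is
    accepted exactly when it is the value of \<open>f\<close> at the set of points accepted before
    it.\<close>
  define P where "P = wfrec {(x, y). x \<sqsubset> y} (\<lambda>P b. b \<in> Y \<and> f {x. x \<sqsubset> b \<and> P x} = b)"
  have P: "P b \<longleftrightarrow> b \<in> Y \<and> f {x. x \<sqsubset> b \<and> P x} = b" for b
    unfolding P_def by (subst wfrec[OF wf]) (simp add: cut_def cong: conj_cong)
  define B where "B = {b. P b}"
  have below: "below B b = {x. x \<sqsubset> b \<and> P x}" for b
    by (auto simp: below_def B_def)
  have "B \<subseteq> Y"
    unfolding B_def using P by blast
  moreover have "uncountable B"
  proof
    assume "countable B"
    with f[of B] \<open>B \<subseteq> Y\<close> have fB: "f B \<in> Y" "\<forall>x\<in>B. x \<sqsubset> f B"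
      by auto
    then have "below B (f B) = B"
      by (auto simp: below_def)
    then have "P (f B)"
      using P[of "f B"] below[of "f B"] fB by metis
    then have "f B \<in> B"
      by (simp add: B_def)
    with fB irrefl show False
      by blast
  qed
  moreover have "f (below B b) = b" if "b \<in> B" for b
    using that P[of b] below[of b] unfolding B_def by (metis mem_Collect_eq)
  ultimately show thesis
    using that by blast
qed

text \<open>Open sets with countable trace on \<open>G\<close> cover \<open>L\<close>, and countably
  many of them cannot cover the uncountable \<open>G\<close>. As \<open>L\<close> may exceed
  \<open>G\<close>, such a set is found at every point of \<open>L\<close>: off the branch, at a
  ray, and at a node.\<close>

lemma not_Lindelof_graph:
  assumes B: "B \<subseteq> Y" "uncountable B"
    and L: "L \<subseteq> branch_points \<times> Y" "\<And>b. b \<in> B \<Longrightarrow> (Node (below B b), b) \<in> L"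
  shows "\<not> Lindelof_space (subtopology (prod_topology branch_top left_top) L)"
proof
  assume Lind: "Lindelof_space (subtopology (prod_topology branch_top left_top) L)"
  define G where "G = (\<lambda>b. (Node (below B b), b)) ` B"
  define \<U> where "\<U> = {U. openin (prod_topology branch_top left_top) U \<and> countable (U \<inter> G)}"
  have "\<exists>U\<in>\<U>. p \<in> U" if p_in: "p \<in> L" for p
  proof -
    obtain x y where p: "p = (x, y)" "x \<in> branch_points" "y \<in> Y"
      using p_in L(1) by blast
    have *: ?thesis if "openin branch_top U" "openin left_top V" "x \<in> U" "y \<in> V"
      "countable (U \<times> V \<inter> G)" for U V
    proof
      show "U \<times> V \<in> \<U>"
        using that unfolding \<U>_def by (simp add: openin_prod_Times_iff)
    qed (use that p in simp)
    have Y: "openin left_top Y"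
      by (metis openin_topspace topspace_left_top)
    show ?thesis
    proof (cases "x \<in> tube B UNIV {}")
      case False
      have "(branch_points - tube B UNIV {}) \<times> Y \<inter> G = {}"
        by (auto simp: G_def tube_def)
      with False Y p openin_Compl_tube[OF B(1)] show ?thesis
        by (intro *[of "branch_points - tube B UNIV {}" Y]) auto
    next
      case True
      then consider r where "x = Ray B r" "r \<notin> Y" | b where "b \<in> B" "x = Node (below B b)"
        by (auto simp: tube_def)
      then show ?thesis
      proof cases
        case 1
        \<comment> \<open>Rays sit at reals outside \<open>Y\<close>, whereas second coordinates lie
          in \<open>Y\<close>.\<close>
        then have "r \<noteq> y"
          using p by auto
        then obtain V V' :: "real set" where V: "open V" "open V'" "r \<in> V" "y \<in> V'" "V \<inter> V' = {}"
          using separation_t2 by metis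
        \<comment> \<open>In a pair from \<open>G\<close> the node sits at the second coordinate,
          which cannot lie in both \<open>V\<close> and \<open>V'\<close>.\<close>
        have "tube B V {} \<times> (V' \<inter> Y) \<inter> G = {}"
          using V Node_in_tube_iff[of _ B V "{}"] by (auto simp: G_def)
        with V 1 p B show ?thesis
          by (intro *[OF openin_tube[of B V "{}"] openin_left_top_Int[of V']]) (auto simp: tube_def)
      next
        case 2
        have "{x} \<times> Y \<inter> G \<subseteq> {(x, b)}"
          using 2 inj_on_below[of B] by (auto simp: G_def dest: inj_onD)
        then have "countable ({x} \<times> Y \<inter> G)"
          by (rule countable_subset) simp
        with 2 p Y show ?thesis
          by (intro *[of "{x}" Y]) (auto simp: openin_Node branch_points_def)
      qed
    qed
  qed
  then have "L \<subseteq> \<Union>\<U>"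
    by blast
  moreover have "L \<subseteq> topspace (prod_topology branch_top left_top)"
    using L by simp
  ultimately obtain \<V> where \<V>: "countable \<V>" "\<V> \<subseteq> \<U>" "L \<subseteq> \<Union>\<V>"
    using Lind unfolding Lindelof_space_subtopology_subset[OF \<open>L \<subseteq> topspace _\<close>]
    by (metis (no_types, lifting) \<U>_def mem_Collect_eq)
  have "G \<subseteq> (\<Union>V\<in>\<V>. V \<inter> G)"
    using \<V>(3) L(2) by (auto simp: G_def)
  moreover have "countable (\<Union>V\<in>\<V>. V \<inter> G)"
    using \<V> by (intro countable_UN) (auto simp: \<U>_def)
  ultimately have "countable G"
    using countable_subset by blast
  then have "countable (snd ` G)"
    by blast
  moreover have "snd ` G = B"
    by (force simp: G_def)
  ultimately show False
    using B by simp
qed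

lemma not_cellular_Lindelof_prod: "\<not> cellular_Lindelof (prod_topology branch_top left_top)"
proof
  assume cL: "cellular_Lindelof (prod_topology branch_top left_top)"
  \<comment> \<open>All countable \<open>a\<close> are used, because the branch is built only
    afterwards, from the \<open>f\<close> that \<open>L\<close> provides; the first coordinates keep
    the boxes disjoint.\<close>
  define box where "box a = {Node a} \<times> {y \<in> Y. \<forall>x\<in>a. x \<sqsubset> y}" for a
  let ?\<U> = "box ` {a. a \<subseteq> Y \<and> countable a}"
  have "openin (prod_topology branch_top left_top) (box a) \<and> box a \<noteq> {}" if "a \<subseteq> Y" "countable a" for a
  proof -
    have "{y \<in> Y. \<forall>x\<in>a. x \<sqsubset> y} \<noteq> {}"
      using uncountable_above[of a] that by (metis countable_empty)
    then show ?thesis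
      unfolding box_def using that
      by (auto simp: openin_prod_Times_iff openin_Node openin_left_top_above)
  qed
  moreover have "pairwise disjnt ?\<U>"
    by (auto simp: pairwise_def disjnt_def box_def)
  ultimately have "(\<forall>U\<in>?\<U>. openin (prod_topology branch_top left_top) U \<and> U \<noteq> {}) \<and> pairwise disjnt ?\<U>"
    by blast
  with cL obtain L where L: "L \<subseteq> topspace (prod_topology branch_top left_top)"
    "Lindelof_space (subtopology (prod_topology branch_top left_top) L)" "\<forall>U\<in>?\<U>. L \<inter> U \<noteq> {}"
    unfolding cellular_Lindelof_def by meson
  have "\<exists>y. (Node a, y) \<in> L \<and> y \<in> Y \<and> (\<forall>x\<in>a. x \<sqsubset> y)" if "a \<subseteq> Y" "countable a" for a
  proof -
    have "L \<inter> box a \<noteq> {}"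
      using L that by blast
    then show ?thesis
      by (auto simp: box_def)
  qed
  then obtain f where f: "\<And>a. a \<subseteq> Y \<Longrightarrow> countable a \<Longrightarrow>
      (Node a, f a) \<in> L \<and> f a \<in> Y \<and> (\<forall>x\<in>a. x \<sqsubset> f a)"
    by metis
  then obtain B where B: "B \<subseteq> Y" "uncountable B" "\<And>b. b \<in> B \<Longrightarrow> f (below B b) = b"
    using ex_guided_branch[of f] by metis
  have nodes: "(Node (below B b), b) \<in> L" if "b \<in> B" for b
  proof -
    have "below B b \<subseteq> Y" "countable (below B b)"
      using B that countable_below[of b] by (auto simp: below_def intro: countable_subset[rotated])
    then have "(Node (below B b), f (below B b)) \<in> L"
      using f by blast
    with B(3)[OF that] show ?thesis
      by simp
  qed
  have "L \<subseteq> branch_points \<times> Y"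
    using L(1) by simp
  from not_Lindelof_graph[OF B(1,2) this nodes] L(2) show False
    by blast
qed

end

section \<open>Transport to the type \<open>point\<close>\<close>

text \<open>The topology is pulled back along \<open>inv e\<close>, on the image of the space only,
  which excludes the points where \<open>inv e\<close> is arbitrary.\<close>

lemma homeomorphic_copy:
  fixes X :: "'a topology" and e :: "'a \<Rightarrow> 'b"
  assumes "inj e"
  obtains X' :: "'b topology" where "X homeomorphic_space X'"
proof
  let ?X' = "pullback_topology (e ` topspace X) (inv e) X"
  have top: "topspace ?X' = e ` topspace X"
    using assms by (auto simp: topspace_pullback_topology)
  have openin: "openin ?X' S \<longleftrightarrow> (\<exists>U. openin X U \<and> S = e ` U)" for S
  proof -
    have "inv e -` U \<inter> e ` topspace X = e ` U" if "openin X U" for U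
      using openin_subset[OF that] assms by auto
    then show ?thesis
      unfolding openin_pullback_topology by metis
  qed
  have "continuous_map X ?X' e"
    unfolding continuous_map_def
  proof (intro conjI allI impI)
    fix S assume "openin ?X' S"
    then obtain U where U: "openin X U" "S = e ` U"
      using openin by blast
    then have "{x \<in> topspace X. e x \<in> S} = U"
      using openin_subset[OF U(1)] by (auto simp: inj_image_mem_iff[OF assms])
    with U show "openin X {x \<in> topspace X. e x \<in> S}"
      by simp
  qed (simp add: top)
  moreover have "open_map X ?X' e"
    unfolding open_map_def using openin by blast
  moreover have "inj_on e (topspace X)"
    using assms inj_on_subset by blast
  ultimately have "homeomorphic_map X ?X' e"
    using top by (intro bijective_open_imp_homeomorphic_map) auto
  then show "X homeomorphic_space ?X'"
    by (rule homeomorphic_map_imp_homeomorphic_space)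
qed

lemma Lindelof_imp_cellular_Lindelof:
  assumes "Lindelof_space X"
  shows "cellular_Lindelof X"
proof -
  have "topspace X \<inter> U \<noteq> {}" if "openin X U" "U \<noteq> {}" for U
    using openin_subset[OF that(1)] that(2) by blast
  then show ?thesis
    unfolding cellular_Lindelof_def using assms by (metis order_refl subtopology_topspace)
qed

lemma cellular_Lindelof_homeomorphic:
  assumes "X homeomorphic_space X'" "cellular_Lindelof X"
  shows "cellular_Lindelof X'"
  unfolding cellular_Lindelof_def
proof (intro allI impI; elim conjE)
  fix \<U> assume \<U>: "\<forall>U\<in>\<U>. openin X' U \<and> U \<noteq> {}" "pairwise disjnt \<U>"
  obtain h g where hg: "homeomorphic_maps X X' h g"
    using assms by (auto simp: homeomorphic_space_def)
  then have h: "homeomorphic_map X X' h" and g: "homeomorphic_map X' X g"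
    using homeomorphic_maps_map by blast+
  have gU: "openin X (g ` U) \<and> g ` U \<noteq> {}" if "U \<in> \<U>" for U
    using \<U> that g homeomorphic_map_openness_eq by blast
  have "pairwise disjnt ((`) g ` \<U>)"
  proof (rule pairwise_imageI)
    fix U V assume UV: "U \<in> \<U>" "V \<in> \<U>" "U \<noteq> V"
    then have "disjnt U V" "U \<subseteq> topspace X'" "V \<subseteq> topspace X'"
      using \<U> by (auto simp: pairwise_def openin_subset)
    then show "disjnt (g ` U) (g ` V)"
      using homeomorphic_imp_injective_map[OF g] by (auto simp: disjnt_def dest: inj_onD)
  qed
  with gU have "(\<forall>V\<in>(`) g ` \<U>. openin X V \<and> V \<noteq> {}) \<and> pairwise disjnt ((`) g ` \<U>)"
    by blast
  with assms(2) obtain L where L: "L \<subseteq> topspace X" "Lindelof_space (subtopology X L)"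
    "\<forall>V\<in>(`) g ` \<U>. L \<inter> V \<noteq> {}"
    unfolding cellular_Lindelof_def by meson
  have hL: "h ` L \<subseteq> topspace X'"
    using homeomorphic_imp_surjective_map[OF h] L(1) by (metis image_mono)
  have "homeomorphic_map (subtopology X L) (subtopology X' (h ` L)) h"
    using L(1) hL by (intro homeomorphic_map_subtopologies[OF h]) (simp add: Int_absorb1)
  then have "Lindelof_space (subtopology X' (h ` L))"
    using L(2) homeomorphic_imp_continuous_map homeomorphic_imp_surjective_map
      Lindelof_space_continuous_map_image by metis
  moreover have "h ` L \<inter> U \<noteq> {}" if "U \<in> \<U>" for U
  proof -
    have "L \<inter> g ` U \<noteq> {}"
      using L(3) that by blast
    then obtain u where "u \<in> U" "g u \<in> L"
      by blast
    moreover have "h (g u) = u"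
      using hg \<U> that \<open>u \<in> U\<close> by (meson homeomorphic_maps_def openin_subset subsetD)
    ultimately show ?thesis
      by force
  qed
  ultimately show "\<exists>L\<subseteq>topspace X'. Lindelof_space (subtopology X' L) \<and> (\<forall>U\<in>\<U>. L \<inter> U \<noteq> {})"
    using hL by blast
qed

lemma countable_spread_homeomorphic:
  assumes "X homeomorphic_space X'" "countable_spread X"
  shows "countable_spread X'"
  unfolding countable_spread_def
proof (intro allI impI)
  fix D assume D: "D \<subseteq> topspace X'" "subtopology X' D = discrete_topology D"
  obtain g where g: "homeomorphic_map X' X g"
    using assms(1) homeomorphic_space homeomorphic_space_sym by blast
  then have inj: "inj_on g D"
    using homeomorphic_imp_injective_map inj_on_subset D(1) by blast
  have gD: "g ` D \<subseteq> topspace X"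
    using homeomorphic_imp_surjective_map[OF g] D(1) by (metis image_mono)
  have "homeomorphic_map (subtopology X' D) (subtopology X (g ` D)) g"
    using D(1) gD by (intro homeomorphic_map_subtopologies[OF g]) (simp add: Int_absorb1)
  then have "openin (subtopology X (g ` D)) {g x}" if "x \<in> D" for x
    using homeomorphic_map_openness_eq[of "discrete_topology D" _ g "{x}"] that D(2) by auto
  then have "discrete_topology (g ` D) = subtopology X (g ` D)"
    using gD unfolding discrete_topology_unique by auto
  then have "countable (g ` D)"
    using assms(2) gD unfolding countable_spread_def by metis
  then show "countable D"
    using inj countable_image_inj_on by blast
qed

text \<open>The three kinds of code have one, two and no members. In the code of a ray, the empty
  set marks the member that carries \<open>r\<close>.\<close>

primrec code :: "branch_point \<Rightarrow> point" where
  "code (Node a) = {{{a}}}"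
| "code (Ray B r) = {{{B}}, {{}, {{r}}}}"
| "code Infty = {}"

lemma inj_code: "inj code"
proof (rule injI)
  show "code x = code y \<Longrightarrow> x = y" for x y
    by (cases x; cases y) (auto simp: doubleton_eq_iff)
qed

theorem mainTheorem1:
  shows "\<exists>(X :: point topology) (Y :: point topology).
           Hausdorff_space X \<and> cellular_Lindelof X \<and>
           Hausdorff_space Y \<and> countable_spread Y \<and>
           \<not> cellular_Lindelof (prod_topology X Y)"
proof -
  obtain Y less where "imperfect_well_order Y less"
    using ex_imperfect_well_order by blast
  then interpret imperfect_well_order Y less .
  obtain X' :: "point topology" where X': "branch_top homeomorphic_space X'"
    using homeomorphic_copy[OF inj_code] .
  have "inj (\<lambda>r :: real. {{{{r}}}})"
    by (rule injI) simp
  then obtain Y' :: "point topology" where Y': "left_top homeomorphic_space Y'"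
    using homeomorphic_copy by blast
  have "cellular_Lindelof branch_top"
    by (intro Lindelof_imp_cellular_Lindelof Lindelof_branch_top)
  then have "cellular_Lindelof X'"
    using X' cellular_Lindelof_homeomorphic by blast
  moreover have "Hausdorff_space X'" "Hausdorff_space Y'"
    using X' Y' Hausdorff_branch_top Hausdorff_left_top homeomorphic_Hausdorff_space by blast+
  moreover have "countable_spread Y'"
    using Y' countable_spread_left_top countable_spread_homeomorphic by blast
  moreover have "\<not> cellular_Lindelof (prod_topology X' Y')"
    using X' Y' not_cellular_Lindelof_prod cellular_Lindelof_homeomorphic
      homeomorphic_space_prod_topology homeomorphic_space_sym by metis
  ultimately show ?thesis
    by blast
qed

end
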